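(* Let $\sigma:\Sigma\to\Sigma$ be a one-sided subshift of finite type. If $u\in C^0(\Sigma)$ is a calibrated sub-action for a $\theta$-Hölder potential $A\in C^\theta(\hat\Sigma)$, then for every $\bar{\mathbf x}\in\Sigma$ $$u(\bar{\mathbf x})=\inf_{\mathbf x\in\Omega(A)}\bigl[u(\mathbf x)+S_A(\mathbf x,\bar{\mathbf x})\bigr].$$
   Context: Let $\mathbf M$ be an $r\times r$ matrix with entries in $\{0,1\}$. The one-sided subshift of finite type is $\Sigma=\{\mathbf x=(x_0,x_1,\ldots)\in\{1,\ldots,r\}^{\mathbb N}:\mathbf M(x_j,x_{j+1})=1\ \forall j\ge 0\}$ (nonempty), with the left shift $\sigma(x_0,x_1,\ldots)=(x_1,x_2,\ldots)$. Fix $\lambda\in(0,1)$; $\Sigma$ has the metric $d(\mathbf x,\bar{\mathbf x})=\lambda^{k}$, $k=\min\{j:x_j\ne\bar x_j\}$ (and $d(\mathbf x,\mathbf x)=0$). The dual space is $\Sigma^*=\{\mathbf y=(\ldots,y_1,y_0)\in\{1,\ldots,r\}^{\mathbb N}:\mathbf M(y_{j+1},y_j)=1\ \forall j\ge0\}$, with the analogous metric. Let $\hat\Sigma=\{(\mathbf y,\mathbf x)\in\Sigma^*\times\Sigma:\mathbf M(y_0,x_0)=1\}$, with the maximum metric induced from the product. Define $\tau:\hat\Sigma\to\Sigma$ by $\tau(\mathbf y,\mathbf x)=\tau_{\mathbf y}(\mathbf x)=(y_0,x_0,x_1,\ldots)$, and for $\mathbf x\in\Sigma$ let $\Sigma^*_{\mathbf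 x}=\{\mathbf y\in\Sigma^*:(\mathbf y,\mathbf x)\in\hat\Sigma\}$. $C^0(\cdot)$ denotes real-valued continuous functions and $C^\theta(\cdot)$ (with $\theta>0$) the $\theta$-Hölder ones. The set $\mathcal M_0$ of holonomic probabilities is the set of Borel probability measures $\hat\mu$ on $\hat\Sigma$ such that $\int f(\tau_{\mathbf y}(\mathbf x))\,d\hat\mu(\mathbf y,\mathbf x)=\int f(\mathbf x)\,d\hat\mu(\mathbf y,\mathbf x)$ for all $f\in C^0(\Sigma)$. For $A\in C^0(\hat\Sigma)$, $\beta_A=\max_{\hat\mu\in\mathcal M_0}\int_{\hat\Sigma}A\,d\hat\mu$. A calibrated sub-action for $A$ is $u\in C^0(\Sigma)$ with $u(\mathbf x)=\min_{\mathbf y\in\Sigma^*_{\mathbf x}}[u(\tau_{\mathbf y}(\mathbf x))-A(\mathbf y,\mathbf x)+\beta_A]$ for all $\mathbf x\in\Sigma$ (the minimum being attained over a nonempty set $\Sigma^*_{\mathbf x}$). For $\epsilon>0$ and $\mathbf x,\bar{\mathbf x}\in\Sigma$, $\mathcal P(\mathbf x,\bar{\mathbf x},\epsilon)$ is the set of finite sequences (paths) $(\mathbf y^0,\mathbf x^0),\ldots,(\mathbf y^{k-1},\mathbf x^{k-1})\in\hat\Sigma$, $k\ge1$, with $\mathbf x^0=\bar{\mathbf x}$, $\mathbf x^{j+1}=\tau_{\mathbf y^j}(\mathbf x^j)$ for $0\le j<k-1$, and $d(\tau_{\mathbf y^{k-1}}(\mathbf x^{k-1}),\mathbf x)<\epsilon$.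 The set of non-wandering points $\Omega(A)$ consists of those $\mathbf x\in\Sigma$ such that for every $\epsilon>0$ there is a path in $\mathcal P(\mathbf x,\mathbf x,\epsilon)$ with $|\sum_{j=0}^{k-1}(A-\beta_A)(\mathbf y^j,\mathbf x^j)|<\epsilon$. The Mañé potential $S_A:\Sigma\times\Sigma\to\mathbb R\cup\{\pm\infty\}$ is $S_A(\mathbf x,\bar{\mathbf x})=\lim_{\epsilon\to0}S_A^\epsilon(\mathbf x,\bar{\mathbf x})$, where $S_A^\epsilon(\mathbf x,\bar{\mathbf x})=\inf\bigl[-\sum_{j=0}^{k-1}(A-\beta_A)(\mathbf y^j,\mathbf x^j)\bigr]$, the infimum being over all paths in $\mathcal P(\mathbf x,\bar{\mathbf x},\epsilon)$ ($\inf\emptyset=+\infty$). *)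

theory Defs
  imports "HOL-Probability.Probability"
begin

text \<open>
  A sequence over the alphabet {1..r} is a function of type \<open>nat \<Rightarrow> nat\<close>; a point
  \<open>(\<dots>, y\<^sub>1, y\<^sub>0)\<close> of the dual space is the function \<open>y\<close> with \<open>y j = y\<^sub>j\<close>, so its
  admissibility condition reads \<open>M (y (Suc j)) (y j) = 1\<close>. The spaces are subsets of their types;
  functions on them are total, but only their values on the carriers are ever used.
\<close>

type_synonym word = "nat \<Rightarrow> nat"

definition shift_space :: "nat \<Rightarrow> (nat \<Rightarrow> nat \<Rightarrow> nat) \<Rightarrow> word set" where
  "shift_space r M = {x. (\<forall>j. x j \<in> {1..r}) \<and> (\<forall>j. M (x j) (x (Suc j)) = 1)}"

definition dual_space :: "nat \<Rightarrow> (nat \<Rightarrow> nat \<Rightarrow> nat) \<Rightarrow> word set" where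
  "dual_space r M = {y. (\<forall>j. y j \<in> {1..r}) \<and> (\<forall>j. M (y (Suc j)) (y j) = 1)}"

definition hat_space :: "nat \<Rightarrow> (nat \<Rightarrow> nat \<Rightarrow> nat) \<Rightarrow> (word \<times> word) set" where
  "hat_space r M = {(y, x) \<in> dual_space r M \<times> shift_space r M. M (y 0) (x 0) = 1}"

definition dual_fibre :: "nat \<Rightarrow> (nat \<Rightarrow> nat \<Rightarrow> nat) \<Rightarrow> word \<Rightarrow> word set" where
  "dual_fibre r M x = {y \<in> dual_space r M. (y, x) \<in> hat_space r M}"

fun tau :: "word \<times> word \<Rightarrow> word" where
  "tau (y, x) = case_nat (y 0) x"

definition word_dist :: "real \<Rightarrow> word \<Rightarrow> word \<Rightarrow> real" where
  "word_dist lam x x' = (if x = x' then 0 else lam ^ (LEAST j. x j \<noteq> x' j))"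

definition hat_dist :: "real \<Rightarrow> word \<times> word \<Rightarrow> word \<times> word \<Rightarrow> real" where
  "hat_dist lam p q = max (word_dist lam (fst p) (fst q)) (word_dist lam (snd p) (snd q))"

lemma Metric_space_word_dist:
  assumes "0 < lam" "lam < 1"
  shows "Metric_space S (word_dist lam)"
proof
  fix x y z :: word
  show "0 \<le> word_dist lam x y"
    using assms by (simp add: word_dist_def)
  show "word_dist lam x y = word_dist lam y x"
    by (simp add: word_dist_def eq_commute)
  show "word_dist lam x y = 0 \<longleftrightarrow> x = y"
    using assms by (simp add: word_dist_def)
  show "word_dist lam x z \<le> word_dist lam x y + word_dist lam y z"
  proof (cases "x = y \<or> y = z \<or> x = z")
    case True
    then show ?thesis using assms by (auto simp: word_dist_def)
  next
    case False
    define k where "k = (LEAST j. x j \<noteq> z j)"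
    define a where "a = (LEAST j. x j \<noteq> y j)"
    define b where "b = (LEAST j. y j \<noteq> z j)"
    have "x k \<noteq> z k"
      unfolding k_def by (rule LeastI_ex) (use False in auto)
    then have "x k \<noteq> y k \<or> y k \<noteq> z k" by auto
    then have "a \<le> k \<or> b \<le> k"
      unfolding a_def b_def by (auto intro: Least_le)
    then have "lam ^ k \<le> lam ^ a \<or> lam ^ k \<le> lam ^ b"
      using assms by (auto intro: power_decreasing)
    moreover have "0 < lam ^ a" "0 < lam ^ b" using assms by auto
    ultimately show ?thesis
      using False by (auto simp: word_dist_def a_def b_def k_def)
  qed
qed

lemma Metric_space_hat_dist:
  assumes "0 < lam" "lam < 1"
  shows "Metric_space S (hat_dist lam)"
proof -
  interpret W: Metric_space UNIV "word_dist lam"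
    by (rule Metric_space_word_dist[OF assms])
  show ?thesis
  proof
    fix p q s :: "word \<times> word"
    show "0 \<le> hat_dist lam p q" by (simp add: hat_dist_def le_max_iff_disj)
    show "hat_dist lam p q = hat_dist lam q p" by (simp add: hat_dist_def W.commute)
    show "hat_dist lam p q = 0 \<longleftrightarrow> p = q"
    proof -
      have "0 \<le> word_dist lam (fst p) (fst q)" "0 \<le> word_dist lam (snd p) (snd q)"
        by simp_all
      then have "hat_dist lam p q = 0 \<longleftrightarrow>
          word_dist lam (fst p) (fst q) = 0 \<and> word_dist lam (snd p) (snd q) = 0"
        unfolding hat_dist_def by linarith
      then show ?thesis by (simp add: prod_eq_iff)
    qed
    show "hat_dist lam p s \<le> hat_dist lam p q + hat_dist lam q s"
      using W.triangle[of "fst p" "fst q" "fst s"] W.triangle[of "snd p" "snd q" "snd s"]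
      unfolding hat_dist_def by (auto simp: max_def)
  qed
qed

definition shift_top :: "nat \<Rightarrow> (nat \<Rightarrow> nat \<Rightarrow> nat) \<Rightarrow> real \<Rightarrow> word topology" where
  "shift_top r M lam = Metric_space.mtopology (shift_space r M) (word_dist lam)"

definition hat_top :: "nat \<Rightarrow> (nat \<Rightarrow> nat \<Rightarrow> nat) \<Rightarrow> real \<Rightarrow> (word \<times> word) topology" where
  "hat_top r M lam = Metric_space.mtopology (hat_space r M) (hat_dist lam)"

definition Holder_on_hat ::
    "nat \<Rightarrow> (nat \<Rightarrow> nat \<Rightarrow> nat) \<Rightarrow> real \<Rightarrow> real \<Rightarrow> (word \<times> word \<Rightarrow> real) \<Rightarrow> bool" where
  "Holder_on_hat r M lam \<theta> A \<longleftrightarrow>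
     (\<exists>C\<ge>0. \<forall>p\<in>hat_space r M. \<forall>q\<in>hat_space r M.
        \<bar>A p - A q\<bar> \<le> C * hat_dist lam p q powr \<theta>)"

definition holonomic_probs ::
    "nat \<Rightarrow> (nat \<Rightarrow> nat \<Rightarrow> nat) \<Rightarrow> real \<Rightarrow> (word \<times> word) measure set" where
  "holonomic_probs r M lam =
     {\<mu>. prob_space \<mu> \<and>
         sets \<mu> = sets (sigma (hat_space r M) {U. openin (hat_top r M lam) U}) \<and>
         (\<forall>f. continuous_map (shift_top r M lam) euclideanreal f \<longrightarrow>
            (\<integral>p. f (tau p) \<partial>\<mu>) = (\<integral>p. f (snd p) \<partial>\<mu>))}"

text \<open>The maximum exists whenever some holonomic probability exists and \<open>A\<close> is continuous, by
  weak compactness.\<close>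

definition beta ::
    "nat \<Rightarrow> (nat \<Rightarrow> nat \<Rightarrow> nat) \<Rightarrow> real \<Rightarrow> (word \<times> word \<Rightarrow> real) \<Rightarrow> real" where
  "beta r M lam A = (GREATEST b. b \<in> (\<lambda>\<mu>. \<integral>p. A p \<partial>\<mu>) ` holonomic_probs r M lam)"

definition calibrated_subaction ::
    "nat \<Rightarrow> (nat \<Rightarrow> nat \<Rightarrow> nat) \<Rightarrow> real \<Rightarrow> (word \<times> word \<Rightarrow> real) \<Rightarrow> (word \<Rightarrow> real) \<Rightarrow> bool" where
  "calibrated_subaction r M lam A u \<longleftrightarrow>
     continuous_map (shift_top r M lam) euclideanreal u \<and>
     (\<forall>x\<in>shift_space r M.
        (\<exists>y\<in>dual_fibre r M x. u x = u (tau (y, x)) - A (y, x) + beta r M lam A) \<and>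
        (\<forall>y\<in>dual_fibre r M x. u x \<le> u (tau (y, x)) - A (y, x) + beta r M lam A))"

definition paths ::
    "nat \<Rightarrow> (nat \<Rightarrow> nat \<Rightarrow> nat) \<Rightarrow> real \<Rightarrow> word \<Rightarrow> word \<Rightarrow> real \<Rightarrow> (word \<times> word) list set" where
  "paths r M lam x x' \<epsilon> =
     {ps. ps \<noteq> [] \<and> set ps \<subseteq> hat_space r M \<and> snd (hd ps) = x' \<and>
          (\<forall>j. Suc j < length ps \<longrightarrow> snd (ps ! Suc j) = tau (ps ! j)) \<and>
          word_dist lam (tau (last ps)) x < \<epsilon>}"

definition path_sum ::
    "nat \<Rightarrow> (nat \<Rightarrow> nat \<Rightarrow> nat) \<Rightarrow> real \<Rightarrow> (word \<times> word \<Rightarrow> real) \<Rightarrow> (word \<times> word) list \<Rightarrow> real" where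
  "path_sum r M lam A ps = (\<Sum>j<length ps. A (ps ! j) - beta r M lam A)"

definition nonwandering ::
    "nat \<Rightarrow> (nat \<Rightarrow> nat \<Rightarrow> nat) \<Rightarrow> real \<Rightarrow> (word \<times> word \<Rightarrow> real) \<Rightarrow> word set" where
  "nonwandering r M lam A =
     {x \<in> shift_space r M. \<forall>\<epsilon>>0. \<exists>ps\<in>paths r M lam x x \<epsilon>. \<bar>path_sum r M lam A ps\<bar> < \<epsilon>}"

definition mane_eps ::
    "nat \<Rightarrow> (nat \<Rightarrow> nat \<Rightarrow> nat) \<Rightarrow> real \<Rightarrow> (word \<times> word \<Rightarrow> real) \<Rightarrow> real \<Rightarrow> word \<Rightarrow> word \<Rightarrow> ereal" where
  "mane_eps r M lam A \<epsilon> x x' = (INF ps\<in>paths r M lam x x' \<epsilon>. ereal (- path_sum r M lam A ps))"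

definition mane_potential ::
    "nat \<Rightarrow> (nat \<Rightarrow> nat \<Rightarrow> nat) \<Rightarrow> real \<Rightarrow> (word \<times> word \<Rightarrow> real) \<Rightarrow> word \<Rightarrow> word \<Rightarrow> ereal" where
  "mane_potential r M lam A x x' = Lim (at_right 0) (\<lambda>\<epsilon>. mane_eps r M lam A \<epsilon> x x')"

end

theory Submission
  imports Defs
begin

text \<open>
  Write \<open>\<beta>\<close> for \<open>beta r M lam A\<close>. Calibration says two things:
  \<open>u x \<le> u (\<tau> (y, x)) - (A - \<beta>) (y, x)\<close> for every admissible \<open>(y, x)\<close>, and for every \<open>x\<close> some \<open>y\<close>
  attains equality.

  For the upper bound on \<open>u xbar\<close>, the inequality telescopes along a path starting at \<open>xbar\<close>
  (\<open>subaction_le_path\<close>): the value \<open>u xbar\<close> is at most \<open>u\<close> at the endpoint minus the sum of \<open>A - \<beta>\<close>.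
  If the endpoint is close to \<open>x\<close>, continuity of \<open>u\<close> at \<open>x\<close> turns this into
  \<open>u xbar \<le> u x + S(x, xbar)\<close> (\<open>subaction_le_mane_potential\<close>), whichever \<open>x\<close> is chosen.

  For the converse, apply calibration over and over to obtain an infinite orbit
  \<open>X\<^sub>0 = xbar, X\<^sub>1, X\<^sub>2, \<dots>\<close> of inverse branches along which the telescoping is exact. The alphabet is
  finite, so the orbit accumulates at some \<open>x\<close>, and its initial segments ending near \<open>x\<close> show
  \<open>S(x, xbar) \<le> u xbar - u x\<close> (\<open>mane_potential_le_accumulation\<close>). It remains that \<open>x\<close> is
  non-wandering (\<open>accumulation_nonwandering\<close>). Between two visits near \<open>x\<close> the sum of \<open>A - \<beta>\<close> along
  the orbit is a difference of two values of \<open>u\<close> near \<open>u x\<close>, hence small. Such a segment starts near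
  \<open>x\<close> rather than at \<open>x\<close>; but the same inverse branches can be applied to \<open>x\<close> itself, and since each
  branch contracts distances by \<open>lam\<close>, Hoelder continuity bounds the difference of the two sums by a
  geometric series (\<open>holder_sum_shadowing\<close>).
\<close>

section \<open>Words agreeing on an initial segment\<close>

definition agree :: "nat \<Rightarrow> word \<Rightarrow> word \<Rightarrow> bool" where
  "agree n x x' \<longleftrightarrow> (\<forall>i<n. x i = x' i)"

lemma agree_sym: "agree n x x' \<Longrightarrow> agree n x' x"
  by (simp add: agree_def)

lemma agree_trans: "agree n x x' \<Longrightarrow> agree n x' x'' \<Longrightarrow> agree n x x''"
  by (simp add: agree_def)

lemma agree_mono: "agree n x x' \<Longrightarrow> m \<le> n \<Longrightarrow> agree m x x'"
  by (simp add: agree_def)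

lemma agree_tau: "agree n x x' \<Longrightarrow> agree (Suc n) (tau (y, x)) (tau (y, x'))"
  by (auto simp: agree_def split: nat.split)

lemma word_dist_le_agree:
  assumes "0 < lam" "lam < 1" "agree n x x'"
  shows "word_dist lam x x' \<le> lam ^ n"
proof (cases "x = x'")
  case False
  then have "\<exists>j. x j \<noteq> x' j" by auto
  then have "x (LEAST j. x j \<noteq> x' j) \<noteq> x' (LEAST j. x j \<noteq> x' j)"
    by (rule LeastI_ex)
  then have "n \<le> (LEAST j. x j \<noteq> x' j)"
    using assms(3) unfolding agree_def by (meson not_le)
  then show ?thesis
    using False assms by (simp add: word_dist_def power_decreasing)
qed (use assms in \<open>simp add: word_dist_def\<close>)

lemma exists_small_power:
  assumes "0 \<le> q" "q < (1::real)" "0 < e"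
  shows "\<exists>N0. \<forall>n\<ge>N0. C * q ^ n < e"
proof -
  have "(\<lambda>n. C * q ^ n) \<longlonglongrightarrow> C * 0"
    by (intro tendsto_intros LIMSEQ_power_zero) (use assms in auto)
  then have "eventually (\<lambda>n. C * q ^ n < e) sequentially"
    using assms by (intro order_tendstoD) auto
  then show ?thesis by (simp add: eventually_sequentially)
qed

lemma continuous_map_shift_close:
  assumes lam: "0 < lam" "lam < 1"
    and u: "continuous_map (shift_top r M lam) euclideanreal u"
    and x: "x \<in> shift_space r M" and d: "0 < d"
  shows "\<exists>e>0. \<forall>z\<in>shift_space r M. word_dist lam z x < e \<longrightarrow> \<bar>u z - u x\<bar> < d"
proof -
  interpret Metric_space "shift_space r M" "word_dist lam"
    by (rule Metric_space_word_dist[OF lam])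
  have "openin mtopology {z \<in> topspace mtopology. u z \<in> ball (u x) d}"
    using u unfolding shift_top_def by (rule openin_continuous_map_preimage) simp
  moreover have "x \<in> {z \<in> topspace mtopology. u z \<in> ball (u x) d}"
    using x d by simp
  ultimately obtain e where "e > 0" "mball x e \<subseteq> {z \<in> topspace mtopology. u z \<in> ball (u x) d}"
    unfolding openin_mtopology by blast
  then show ?thesis
    using x by (intro exI[of _ e]) (auto simp: subset_iff in_mball dist_real_def commute abs_minus_commute)
qed

text \<open>Tychonoff's theorem for the finite alphabet gives a pointwise convergent subsequence, and in a
  discrete alphabet this means that longer and longer initial segments become equal to those of the
  limit. Admissibility is a condition on pairs of adjacent letters and so survives such limits.\<close>

lemma shift_space_subsequence:
  assumes X: "\<And>n. X n \<in> shift_space r M"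
  shows "\<exists>x\<in>shift_space r M. \<exists>s::nat \<Rightarrow> nat. strict_mono s \<and>
           (\<forall>N. \<forall>\<^sub>F n in sequentially. agree N (X (s n)) x)"
proof -
  let ?K = "PiE UNIV (\<lambda>_::nat. {1..r})"
  have "compactin (product_topology (\<lambda>_::nat. euclidean :: nat topology) UNIV) ?K"
    by (simp add: compactin_PiE finite_imp_compact)
  then have "compact ?K"
    by (simp add: euclidean_product_topology)
  then have "seq_compact ?K" by (rule compact_imp_seq_compact)
  moreover have "\<forall>n. X n \<in> ?K" using X by (auto simp: shift_space_def)
  ultimately obtain x s where x: "x \<in> ?K" and s: "strict_mono (s :: nat \<Rightarrow> nat)"
    and lim: "(X \<circ> s) \<longlonglongrightarrow> x"
    unfolding seq_compact_def by metis
  have coord: "\<forall>\<^sub>F n in sequentially. X (s n) i = x i" for i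
  proof -
    have "((\<lambda>n. (X \<circ> s) n i) \<longlongrightarrow> x i) sequentially"
      using continuous_on_tendsto_compose[OF continuous_on_product_coordinates[of i] lim]
      by simp
    then show ?thesis by (simp add: tendsto_discrete)
  qed
  have agr: "\<forall>\<^sub>F n in sequentially. agree N (X (s n)) x" for N
    unfolding agree_def using eventually_ball_finite[of "{..<N}" "\<lambda>n i. X (s n) i = x i" sequentially]
      coord
    by (simp add: Ball_def)
  have "M (x j) (x (Suc j)) = 1" for j
  proof -
    obtain n where "agree (Suc (Suc j)) (X (s n)) x"
      using agr eventually_happens'[OF sequentially_bot] by blast
    then have "X (s n) j = x j" "X (s n) (Suc j) = x (Suc j)" by (auto simp: agree_def)
    moreover have "M (X (s n) j) (X (s n) (Suc j)) = 1"
      using X[of "s n"] by (simp add: shift_space_def)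
    ultimately show ?thesis by simp
  qed
  then have "x \<in> shift_space r M" using x by (auto simp: shift_space_def)
  with s agr show ?thesis by blast
qed

section \<open>Orbits of inverse branches\<close>

lemma tau_in_shift_space: "p \<in> hat_space r M \<Longrightarrow> tau p \<in> shift_space r M"
  by (cases p) (auto simp: hat_space_def dual_space_def shift_space_def split: nat.split)

text \<open>Compatibility of \<open>y\<close> with \<open>x\<close> only concerns the first letter of \<open>x\<close>, which is why the inverse
  branches chosen along one orbit may be applied to a nearby point.\<close>

lemma hat_space_agree:
  assumes "(y, x) \<in> hat_space r M" "agree n x x'" "0 < n" "x' \<in> shift_space r M"
  shows "(y, x') \<in> hat_space r M"
  using assms by (auto simp: hat_space_def agree_def)

lemma orbit_path:
  assumes n: "0 < n" and hat: "\<And>i. i < n \<Longrightarrow> (Y i, Z i) \<in> hat_space r M"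
    and step: "\<And>i. i < n \<Longrightarrow> Z (Suc i) = tau (Y i, Z i)"
    and close: "word_dist lam (Z n) x < e"
  shows "map (\<lambda>i. (Y i, Z i)) [0..<n] \<in> paths r M lam x (Z 0) e"
    and "path_sum r M lam A (map (\<lambda>i. (Y i, Z i)) [0..<n]) = (\<Sum>i<n. A (Y i, Z i) - beta r M lam A)"
proof -
  let ?ps = "map (\<lambda>i. (Y i, Z i)) [0..<n]"
  have "tau (last ?ps) = Z n"
    using n step[of "n - 1"] by (simp add: last_map)
  then show "?ps \<in> paths r M lam x (Z 0) e"
    unfolding paths_def using n hat step close by (auto simp: hd_map)
  show "path_sum r M lam A ?ps = (\<Sum>i<n. A (Y i, Z i) - beta r M lam A)"
    by (simp add: path_sum_def)
qed

lemma orbit_agree: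
  assumes "agree N (Z 0) (X 0)"
    and "\<And>i. Z (Suc i) = tau (Y i, Z i)" and "\<And>i. X (Suc i) = tau (Y i, X i)"
  shows "agree (N + i) (Z i) (X i)"
proof (induction i)
  case (Suc i)
  then show ?case using agree_tau[of "N + i" "Z i" "X i" "Y i"] assms(2,3) by simp
qed (use assms in simp)

text \<open>Distances shrink like \<open>lam ^ (N + i)\<close> along the two orbits, so the Hoelder differences
  of \<open>A\<close> are dominated by a geometric series of ratio \<open>lam powr \<theta>\<close>, and the bound does not depend on
  the number of steps.\<close>

lemma holder_sum_shadowing:
  assumes lam: "0 < lam" "lam < 1" and th: "0 < \<theta>" and C: "0 \<le> C"
    and holder: "\<And>p q. p \<in> hat_space r M \<Longrightarrow> q \<in> hat_space r M \<Longrightarrow>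
      \<bar>A p - A q\<bar> \<le> C * hat_dist lam p q powr \<theta>"
    and Z: "\<And>i. (Y i, Z i) \<in> hat_space r M" and X: "\<And>i. (Y i, X i) \<in> hat_space r M"
    and agr: "\<And>i. agree (N + i) (Z i) (X i)"
  shows "\<bar>(\<Sum>i<n. A (Y i, Z i) - b) - (\<Sum>i<n. A (Y i, X i) - b)\<bar>
           \<le> C / (1 - lam powr \<theta>) * (lam powr \<theta>) ^ N"
proof -
  define q where "q = lam powr \<theta>"
  have q: "0 < q" "q < 1"
    using lam th powr_less_mono2[of \<theta> lam 1] by (auto simp: q_def)
  have term_le: "\<bar>A (Y i, Z i) - A (Y i, X i)\<bar> \<le> C * q ^ N * q ^ i" for i
  proof -
    have nonneg: "0 \<le> word_dist lam (Z i) (X i)"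
      using lam by (simp add: word_dist_def)
    then have "hat_dist lam (Y i, Z i) (Y i, X i) = word_dist lam (Z i) (X i)"
      by (simp add: hat_dist_def) (simp add: word_dist_def)
    then have "\<bar>A (Y i, Z i) - A (Y i, X i)\<bar> \<le> C * word_dist lam (Z i) (X i) powr \<theta>"
      using holder[OF Z X] by metis
    also have "\<dots> \<le> C * (lam ^ (N + i)) powr \<theta>"
      using word_dist_le_agree[OF lam agr] nonneg th C by (intro mult_left_mono powr_mono2) auto
    also have "(lam ^ (N + i)) powr \<theta> = q ^ (N + i)"
      using lam by (simp add: q_def powr_power powr_powr mult.commute flip: powr_realpow)
    finally show ?thesis by (simp add: power_add mult.assoc)
  qed
  have "\<bar>(\<Sum>i<n. A (Y i, Z i) - b) - (\<Sum>i<n. A (Y i, X i) - b)\<bar>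
      = \<bar>\<Sum>i<n. A (Y i, Z i) - A (Y i, X i)\<bar>"
    by (simp add: sum_subtractf)
  also have "\<dots> \<le> (\<Sum>i<n. C * q ^ N * q ^ i)"
    by (rule order_trans[OF sum_abs sum_mono]) (rule term_le)
  also have "\<dots> = C * q ^ N * (\<Sum>i<n. q ^ i)"
    by (simp add: sum_distrib_left)
  also have "\<dots> \<le> C * q ^ N * (1 / (1 - q))"
    using q C by (intro mult_left_mono) (auto simp: sum_gp_strict divide_right_mono)
  finally show ?thesis by (simp add: q_def)
qed

section \<open>The potential as a supremum\<close>

lemma mane_eps_antimono:
  assumes "e \<le> e'"
  shows "mane_eps r M lam A e' x x' \<le> mane_eps r M lam A e x x'"
  unfolding mane_eps_def
  by (rule INF_superset_mono) (use assms in \<open>auto simp: paths_def\<close>)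

text \<open>Shrinking \<open>\<epsilon>\<close> leaves fewer paths and so raises the infimum: the limit at \<open>0\<close> exists and is the
  supremum.\<close>

lemma mane_potential_eq_SUP:
  "mane_potential r M lam A x x' = (SUP e\<in>{0<..}. mane_eps r M lam A e x x')"
proof -
  let ?f = "\<lambda>e. mane_eps r M lam A e x x'"
  have "(?f \<longlongrightarrow> (SUP e\<in>{0<..}. ?f e)) (at_right 0)"
  proof (rule order_tendstoI)
    fix a assume "a < (SUP e\<in>{0<..}. ?f e)"
    then obtain e where e: "0 < e" "a < ?f e" by (auto simp: less_SUP_iff)
    then have "\<forall>t>0. t < e \<longrightarrow> a < ?f t"
      using mane_eps_antimono less_le_trans less_imp_le by meson
    then show "\<forall>\<^sub>F t in at_right 0. a < ?f t"
      using e(1) by (auto simp: eventually_at_right_field)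
  next
    fix a assume "(SUP e\<in>{0<..}. ?f e) < a"
    then have "\<forall>t>0. ?f t < a"
      using SUP_upper le_less_trans by (metis greaterThan_iff)
    then show "\<forall>\<^sub>F t in at_right 0. ?f t < a"
      by (auto simp: eventually_at_right_field intro: exI[of _ 1])
  qed
  then show ?thesis
    unfolding mane_potential_def by (intro tendsto_Lim) auto
qed

section \<open>Sub-actions bound the potential from below\<close>

text \<open>Along each step \<open>u\<close> rises by at least the corresponding term of the sum, by the inequality
  half of calibration; the intermediate values of \<open>u\<close> cancel.\<close>

lemma subaction_le_path:
  assumes cal: "calibrated_subaction r M lam A u" and ps: "ps \<in> paths r M lam x x' e"
  shows "u x' \<le> u (tau (last ps)) - path_sum r M lam A ps"
proof -
  have step: "u (snd p) \<le> u (tau p) - (A p - beta r M lam A)" if "p \<in> hat_space r M" for p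
    using cal that unfolding calibrated_subaction_def dual_fibre_def
    by (cases p) (force simp: hat_space_def)
  have "u (snd (ps ! 0)) \<le> u (tau (ps ! n)) - (\<Sum>j<Suc n. A (ps ! j) - beta r M lam A)"
    if "n < length ps" for n
    using that
  proof (induction n)
    case 0
    then have "ps ! 0 \<in> hat_space r M"
      using ps nth_mem by (auto simp: paths_def)
    then show ?case using step[of "ps ! 0"] by simp
  next
    case (Suc n)
    then have "snd (ps ! Suc n) = tau (ps ! n)" "ps ! Suc n \<in> hat_space r M"
      using ps by (auto simp: paths_def)
    then show ?case using Suc step[of "ps ! Suc n"] by simp
  qed
  moreover have ne: "ps \<noteq> []" using ps by (simp add: paths_def)
  moreover have len: "Suc (length ps - 1) = length ps" using ne by simp
  ultimately have "u (snd (ps ! 0)) \<le> u (tau (ps ! (length ps - 1)))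
      - (\<Sum>j<length ps. A (ps ! j) - beta r M lam A)"
    by (metis lessI)
  then show ?thesis
    using ps ne by (simp add: paths_def path_sum_def hd_conv_nth last_conv_nth)
qed

text \<open>Continuity of \<open>u\<close> at \<open>x\<close> replaces the value of \<open>u\<close> at the end of a path by \<open>u x\<close>, up to an error
  that vanishes with \<open>\<epsilon>\<close>. The potential may be infinite, so the real numbers are
  first collected on the left.\<close>

lemma subaction_le_mane_potential:
  assumes lam: "0 < lam" "lam < 1" and cal: "calibrated_subaction r M lam A u"
    and x: "x \<in> shift_space r M"
  shows "ereal (u x') \<le> ereal (u x) + mane_potential r M lam A x x'"
proof -
  have "ereal (u x' - u x) \<le> mane_potential r M lam A x x'"
  proof (rule ereal_le_epsilon2)
    fix d :: real assume d: "0 < d"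
    obtain e where e: "0 < e"
      and close: "\<And>z. z \<in> shift_space r M \<Longrightarrow> word_dist lam z x < e \<Longrightarrow> \<bar>u z - u x\<bar> < d"
      using continuous_map_shift_close[OF lam _ x d] cal
      unfolding calibrated_subaction_def by blast
    have "ereal (u x' - u x - d) \<le> mane_eps r M lam A e x x'"
      unfolding mane_eps_def
    proof (rule INF_greatest)
      fix ps assume ps: "ps \<in> paths r M lam x x' e"
      then have "tau (last ps) \<in> shift_space r M"
        by (intro tau_in_shift_space) (auto simp: paths_def)
      then have "\<bar>u (tau (last ps)) - u x\<bar> < d"
        using close ps by (simp add: paths_def)
      then show "ereal (u x' - u x - d) \<le> ereal (- path_sum r M lam A ps)"
        using subaction_le_path[OF cal ps] by simp
    qed
    also have "\<dots> \<le> mane_potential r M lam A x x'"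
      unfolding mane_potential_eq_SUP using e by (intro SUP_upper) simp
    finally show "ereal (u x' - u x) \<le> mane_potential r M lam A x x' + ereal d"
      by (cases "mane_potential r M lam A x x'") auto
  qed
  then show ?thesis
    by (cases "mane_potential r M lam A x x'") auto
qed

section \<open>Calibrated orbits and their accumulation points\<close>

definition calibrated_orbit ::
    "nat \<Rightarrow> (nat \<Rightarrow> nat \<Rightarrow> nat) \<Rightarrow> real \<Rightarrow> (word \<times> word \<Rightarrow> real) \<Rightarrow> (word \<Rightarrow> real)
      \<Rightarrow> (nat \<Rightarrow> word) \<Rightarrow> (nat \<Rightarrow> word) \<Rightarrow> bool" where
  "calibrated_orbit r M lam A u Y X \<longleftrightarrow>
     (\<forall>i. (Y i, X i) \<in> hat_space r M \<and> X (Suc i) = tau (Y i, X i) \<and>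
          u (X i) = u (X (Suc i)) - A (Y i, X i) + beta r M lam A)"

lemma calibrated_orbit_exists:
  assumes cal: "calibrated_subaction r M lam A u" and x: "x \<in> shift_space r M"
  shows "\<exists>Y X. X 0 = x \<and> calibrated_orbit r M lam A u Y X"
proof -
  have "\<exists>y. (y, z) \<in> hat_space r M \<and> u z = u (tau (y, z)) - A (y, z) + beta r M lam A"
    if "z \<in> shift_space r M" for z
    using cal that unfolding calibrated_subaction_def dual_fibre_def by blast
  then obtain g where g: "\<And>z. z \<in> shift_space r M \<Longrightarrow>
      (g z, z) \<in> hat_space r M \<and> u z = u (tau (g z, z)) - A (g z, z) + beta r M lam A"
    by metis
  define X where "X = rec_nat x (\<lambda>_ z. tau (g z, z))"
  have X: "X 0 = x" "\<And>i. X (Suc i) = tau (g (X i), X i)"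
    by (simp_all add: X_def)
  have "X i \<in> shift_space r M" for i
    by (induction i) (use x g in \<open>auto simp: X simp del: tau.simps intro!: tau_in_shift_space\<close>)
  then have "calibrated_orbit r M lam A u (\<lambda>i. g (X i)) X"
    unfolding calibrated_orbit_def X(2) using g by blast
  with X(1) show ?thesis by blast
qed

lemma calibrated_orbit_shift:
  "calibrated_orbit r M lam A u Y X \<Longrightarrow>
     calibrated_orbit r M lam A u (\<lambda>i. Y (a + i)) (\<lambda>i. X (a + i))"
  by (simp add: calibrated_orbit_def)

lemma calibrated_orbit_sum:
  assumes "calibrated_orbit r M lam A u Y X"
  shows "(\<Sum>i<n. A (Y i, X i) - beta r M lam A) = u (X n) - u (X 0)"
proof (induction n)
  case (Suc n)
  moreover have "u (X n) = u (X (Suc n)) - A (Y n, X n) + beta r M lam A"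
    using assms unfolding calibrated_orbit_def by blast
  ultimately show ?case by simp
qed simp

lemma accumulation_visit:
  assumes lam: "0 < lam" "lam < 1"
    and u: "continuous_map (shift_top r M lam) euclideanreal u"
    and x: "x \<in> shift_space r M" and X: "\<And>i. X i \<in> shift_space r M"
    and acc: "\<And>N a. \<exists>b>a. agree N (X b) x" and d: "0 < d"
  shows "\<exists>b>a. agree N (X b) x \<and> \<bar>u (X b) - u x\<bar> < d"
proof -
  obtain e where e: "0 < e"
    and close: "\<And>z. z \<in> shift_space r M \<Longrightarrow> word_dist lam z x < e \<Longrightarrow> \<bar>u z - u x\<bar> < d"
    using continuous_map_shift_close[OF lam u x d] by blast
  obtain K where K: "\<forall>n\<ge>K. 1 * lam ^ n < e"
    using exists_small_power[of lam e 1] lam e by auto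
  obtain b where b: "b > a" "agree (max N K) (X b) x"
    using acc by blast
  have "word_dist lam (X b) x < e"
    using word_dist_le_agree[OF lam b(2)] K[rule_format, of "max N K"] by simp
  then show ?thesis
    using b X close agree_mono[OF b(2)] by (intro exI[of _ b]) auto
qed

text \<open>The segments of the orbit from \<open>X 0\<close> up to a late visit near \<open>x\<close> are paths towards \<open>x\<close>, and their
  cost is exactly \<open>u (X 0)\<close> minus a value of \<open>u\<close> close to \<open>u x\<close>.\<close>

lemma mane_potential_le_accumulation:
  assumes lam: "0 < lam" "lam < 1"
    and u: "continuous_map (shift_top r M lam) euclideanreal u"
    and orb: "calibrated_orbit r M lam A u Y X"
    and x: "x \<in> shift_space r M" and acc: "\<And>N a. \<exists>b>a. agree N (X b) x"
  shows "ereal (u x) + mane_potential r M lam A x (X 0) \<le> ereal (u (X 0))"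
proof -
  have hat: "\<And>i. (Y i, X i) \<in> hat_space r M" and step: "\<And>i. X (Suc i) = tau (Y i, X i)"
    using orb unfolding calibrated_orbit_def by blast+
  then have X: "\<And>i. X i \<in> shift_space r M" by (auto simp: hat_space_def)
  have "mane_potential r M lam A x (X 0) \<le> ereal (u (X 0) - u x)"
    unfolding mane_potential_eq_SUP
  proof (rule SUP_least, rule ereal_le_epsilon2)
    fix e d :: real assume e: "e \<in> {0<..}" and d: "0 < d"
    then obtain N where N: "\<forall>n\<ge>N. 1 * lam ^ n < e"
      using exists_small_power[of lam e 1] lam by auto
    obtain b where b: "b > 0" "agree N (X b) x" "\<bar>u (X b) - u x\<bar> < d"
      using accumulation_visit[OF lam u x X acc d] by blast
    have "word_dist lam (X b) x < e"
      using word_dist_le_agree[OF lam b(2)] N[rule_format, of N] by simp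
    note path = orbit_path[OF b(1) hat step this]
    have "mane_eps r M lam A e x (X 0) \<le> ereal (- (u (X b) - u (X 0)))"
      unfolding mane_eps_def
      using path(2) calibrated_orbit_sum[OF orb]
      by (intro INF_lower2[OF path(1)]) simp
    also have "\<dots> \<le> ereal (u (X 0) - u x) + ereal d"
      using b(3) by simp
    finally show "mane_eps r M lam A e x (X 0) \<le> ereal (u (X 0) - u x) + ereal d" .
  qed
  then show ?thesis
    by (cases "mane_potential r M lam A x (X 0)") auto
qed

text \<open>A segment of the orbit between two visits near \<open>x\<close> almost returns and has a sum near \<open>0\<close>, but a
  path for the non-wandering property must start at \<open>x\<close> exactly. Applying the branches of the segment
  to \<open>x\<close> produces such a path: contraction keeps it close to the segment, so it still ends near \<open>x\<close>,
  and shadowing keeps its sum small.\<close>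

lemma accumulation_nonwandering:
  assumes lam: "0 < lam" "lam < 1" and th: "0 < \<theta>" and hold: "Holder_on_hat r M lam \<theta> A"
    and u: "continuous_map (shift_top r M lam) euclideanreal u"
    and orb: "calibrated_orbit r M lam A u Y X"
    and x: "x \<in> shift_space r M" and acc: "\<And>N a. \<exists>b>a. agree N (X b) x"
  shows "x \<in> nonwandering r M lam A"
  unfolding nonwandering_def
proof (intro CollectI conjI allI impI x)
  fix e :: real assume e: "0 < e"
  have X: "\<And>i. X i \<in> shift_space r M"
    using orb unfolding calibrated_orbit_def by (auto simp: hat_space_def)
  obtain C where C: "0 \<le> C" and holder: "\<And>p q. p \<in> hat_space r M \<Longrightarrow> q \<in> hat_space r M \<Longrightarrow>
      \<bar>A p - A q\<bar> \<le> C * hat_dist lam p q powr \<theta>"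
    using hold unfolding Holder_on_hat_def by blast
  have q: "0 \<le> lam powr \<theta>" "lam powr \<theta> < 1"
    using lam th powr_less_mono2[of \<theta> lam 1] by auto
  obtain N1 where N1: "\<forall>n\<ge>N1. 1 * lam ^ n < e"
    using exists_small_power[of lam e 1] lam e by auto
  obtain N2 where N2: "\<forall>n\<ge>N2. C / (1 - lam powr \<theta>) * (lam powr \<theta>) ^ n < e / 2"
    using exists_small_power[OF q, of "e / 2"] e by (metis half_gt_zero)
  \<comment> \<open>\<open>N1\<close> controls the distance at the endpoint and \<open>N2\<close> the shadowing error; the successor makes at
    least the first letters equal, so that the branches of the orbit can be applied to \<open>x\<close>\<close>
  define N where "N = Suc (max N1 N2)"
  obtain a where a: "agree N (X a) x" "\<bar>u (X a) - u x\<bar> < e / 4"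
    using accumulation_visit[OF lam u x X acc, of "e / 4"] e by (metis zero_less_divide_iff zero_less_numeral)
  obtain b where b: "b > a" "agree N (X b) x" "\<bar>u (X b) - u x\<bar> < e / 4"
    using accumulation_visit[OF lam u x X acc, of "e / 4"] e by (metis zero_less_divide_iff zero_less_numeral)
  define n where "n = b - a"
  define V where "V = (\<lambda>i. Y (a + i))"
  define W where "W = (\<lambda>i. X (a + i))"
  have orbW: "calibrated_orbit r M lam A u V W"
    unfolding V_def W_def by (rule calibrated_orbit_shift[OF orb])
  then have hatW: "\<And>i. (V i, W i) \<in> hat_space r M" and stepW: "\<And>i. W (Suc i) = tau (V i, W i)"
    unfolding calibrated_orbit_def by blast+
  \<comment> \<open>the orbit of \<open>x\<close> under the inverse branches used after time \<open>a\<close>\<close>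
  define Z where "Z = rec_nat x (\<lambda>i z. tau (V i, z))"
  have Z0: "Z 0 = x" and stepZ: "\<And>i. Z (Suc i) = tau (V i, Z i)"
    by (simp_all add: Z_def)
  have agr: "agree (N + i) (Z i) (W i)" for i
    by (rule orbit_agree[where Y = V]) (use a(1) Z0 stepZ stepW in \<open>auto simp: W_def agree_sym\<close>)
  have Zs: "Z i \<in> shift_space r M" for i
  proof (induction i)
    case (Suc i)
    then have "(V i, Z i) \<in> hat_space r M"
      by (intro hat_space_agree[OF hatW agree_sym[OF agr]]) (simp_all add: N_def)
    then show ?case unfolding stepZ by (rule tau_in_shift_space)
  qed (simp add: Z0 x)
  have hatZ: "(V i, Z i) \<in> hat_space r M" for i
    by (intro hat_space_agree[OF hatW agree_sym[OF agr]] Zs) (simp add: N_def)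
  have Wn: "W n = X b" using b(1) by (simp add: W_def n_def)
  have "agree N (Z n) x"
    using agree_trans[OF agree_mono[OF agr[of n], of N] b(2)[folded Wn]] by simp
  then have "word_dist lam (Z n) x \<le> lam ^ N"
    by (rule word_dist_le_agree[OF lam])
  also have "\<dots> < e" using N1[rule_format, of N] by (simp add: N_def)
  finally have close: "word_dist lam (Z n) x < e" .
  have n: "0 < n" using b(1) by (simp add: n_def)
  note path = orbit_path[OF n hatZ stepZ close]
  have "\<bar>(\<Sum>i<n. A (V i, Z i) - beta r M lam A) - (\<Sum>i<n. A (V i, W i) - beta r M lam A)\<bar>
      \<le> C / (1 - lam powr \<theta>) * (lam powr \<theta>) ^ N"
    by (rule holder_sum_shadowing[OF lam th C holder hatZ hatW agr])
  also have "\<dots> < e / 2" using N2[rule_format, of N] by (simp add: N_def)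
  finally have "\<bar>(\<Sum>i<n. A (V i, Z i) - beta r M lam A) - (u (X b) - u (X a))\<bar> < e / 2"
    using calibrated_orbit_sum[OF orbW, of n] by (simp add: Wn) (simp add: W_def)
  then have "\<bar>\<Sum>i<n. A (V i, Z i) - beta r M lam A\<bar> < e"
    using a(2) b(3) by linarith
  then have "\<bar>path_sum r M lam A (map (\<lambda>i. (V i, Z i)) [0..<n])\<bar> < e"
    using path(2) by simp
  then show "\<exists>ps\<in>paths r M lam x x e. \<bar>path_sum r M lam A ps\<bar> < e"
    using path(1) unfolding Z0 by blast
qed

section \<open>The representation formula\<close>

theorem theorem10:
  fixes r :: nat and M :: "nat \<Rightarrow> nat \<Rightarrow> nat" and lam \<theta> :: real
    and A :: "word \<times> word \<Rightarrow> real" and u :: "word \<Rightarrow> real" and xbar :: word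
  assumes "\<forall>i\<in>{1..r}. \<forall>j\<in>{1..r}. M i j \<in> {0, 1}"
    and "shift_space r M \<noteq> {}"
    and "0 < lam" and "lam < 1"
    and "0 < \<theta>" and "Holder_on_hat r M lam \<theta> A"
    and "calibrated_subaction r M lam A u"
    and "xbar \<in> shift_space r M"
  shows "ereal (u xbar) =
    (INF x\<in>nonwandering r M lam A. ereal (u x) + mane_potential r M lam A x xbar)"
proof (rule antisym)
  show "ereal (u xbar) \<le>
      (INF x\<in>nonwandering r M lam A. ereal (u x) + mane_potential r M lam A x xbar)"
    by (intro INF_greatest subaction_le_mane_potential[OF assms(3,4,7)])
      (simp add: nonwandering_def)
next
  have u: "continuous_map (shift_top r M lam) euclideanreal u"
    using assms(7) by (simp add: calibrated_subaction_def)
  obtain Y X where X0: "X 0 = xbar" and orb: "calibrated_orbit r M lam A u Y X"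
    using calibrated_orbit_exists[OF assms(7,8)] by blast
  then have "X i \<in> shift_space r M" for i
    unfolding calibrated_orbit_def by (auto simp: hat_space_def)
  from shift_space_subsequence[where X = X, OF this] obtain x s where x: "x \<in> shift_space r M"
    and s: "strict_mono (s :: nat \<Rightarrow> nat)"
    and lim: "\<And>N. \<forall>\<^sub>F n in sequentially. agree N (X (s n)) x"
    by blast
  have acc: "\<exists>b>a. agree N (X b) x" for N a
  proof -
    have "\<forall>\<^sub>F n in sequentially. agree N (X (s n)) x \<and> n > a"
      using lim eventually_gt_at_top by (rule eventually_conj)
    then obtain n where "agree N (X (s n)) x" "n > a"
      using eventually_happens'[OF sequentially_bot] by blast
    then show ?thesis
      using seq_suble[OF s, of n] by (intro exI[of _ "s n"]) auto
  qed
  have nonwandering: "x \<in> nonwandering r M lam A"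
    by (rule accumulation_nonwandering[OF assms(3-6) u orb x acc])
  have "ereal (u x) + mane_potential r M lam A x xbar \<le> ereal (u xbar)"
    using mane_potential_le_accumulation[OF assms(3,4) u orb x acc] unfolding X0 .
  then show "(INF x\<in>nonwandering r M lam A. ereal (u x) + mane_potential r M lam A x xbar)
      \<le> ereal (u xbar)"
    by (intro INF_lower2[OF nonwandering])
qed

end
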